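(* Let $D\subset\mathbb{Z}^2$ and let $\nu:D\to\mathbb{R}^3$ be a discrete co-normal map, i.e. a map satisfying, for $(u,v)\in D$, $$\nu_{12}(u+\tfrac12,v+\tfrac12)=0\qquad\text{and}\qquad F(u+\tfrac12,v+\tfrac12):=\nu(u,v)\cdot(\nu(u,v+1)\times\nu(u+1,v))>0 .$$ Then there exists an immersion $q(u,v)$, $q:D\to\mathbb{R}^3$, such that $$q_1(u+\tfrac12,v)=\nu(u,v)\times\nu(u+1,v),\qquad q_2(u,v+\tfrac12)=-\nu(u,v)\times\nu(u,v+1).$$ Moreover, it satisfies the following properties. (1) The co-normal at $(u,v)$ can be obtained by any of the following formulas: $$\nu(u,v)=\frac{1}{F(u+\tfrac12,v+\tfrac12)}\left(q_1(u+\tfrac12,v)\times q_2(u,v+\tfrac12)\right),$$ $$\nu(u,v)=\frac{1}{F(u-\tfrac12,v+\tfrac12)}\left(q_1(u-\tfrac12,v)\times q_2(u,v+\tfrac12)\right),$$ $$\nu(u,v)=\frac{1}{F(u-\tfrac12,v-\tfrac12)}\left(q_1(u-\tfrac12,v)\times q_2(u,v-\tfrac12)\right),$$ $$\nu(u,v)=\frac{1}{F(u+\tfrac12,v-\tfrac12)}\left(q_1(u+\tfrac12,v)\times q_2(u,v-\tfrac12)\right).$$ (2) The parameterization is asymptotic: $$\left[q_1(u\pm\tfrac12,v),q_2(u,v\pm\tfrac12),q_{11}(u,v)\right]=0,\qquad \left[q_1(u\pm\tfrac12,v),q_2(u,v\pm\tfrac12),q_{22}(u,v)\right]=0,$$ and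 $$\left[q_1(u+\tfrac12,v),q_2(u,v+\tfrac12),q_{12}(u+\tfrac12,v+\tfrac12)\right]=F^2(u+\tfrac12,v+\tfrac12),$$ $$\left[q_1(u+\tfrac12,v),q_2(u+1,v+\tfrac12),q_{12}(u+\tfrac12,v+\tfrac12)\right]=F^2(u+\tfrac12,v+\tfrac12),$$ $$\left[q_1(u+\tfrac12,v+1),q_2(u,v+\tfrac12),q_{12}(u+\tfrac12,v+\tfrac12)\right]=F^2(u+\tfrac12,v+\tfrac12),$$ $$\left[q_1(u+\tfrac12,v+1),q_2(u+1,v+\tfrac12),q_{12}(u+\tfrac12,v+\tfrac12)\right]=F^2(u+\tfrac12,v+\tfrac12).$$
   Context: $\cdot$, $\times$ and $[\cdot,\cdot,\cdot]$ denote the inner product, cross product and determinant in $\mathbb{R}^3$. For a real or vector function $f$ on a subset of $\mathbb{Z}^2$, discrete derivatives are $f_1(u+\tfrac12,v)=f(u+1,v)-f(u,v)$, $f_2(u,v+\tfrac12)=f(u,v+1)-f(u,v)$, $f_{11}(u,v)=f(u+1,v)-2f(u,v)+f(u-1,v)$, $f_{22}(u,v)=f(u,v+1)-2f(u,v)+f(u,v-1)$, $f_{12}(u+\tfrac12,v+\tfrac12)=f(u+1,v+1)+f(u,v)-f(u+1,v)-f(u,v+1)$. The label $(u+\tfrac12,v+\tfrac12)$ denotes the unit square with lower-left vertex $(u,v)$, and $F^2(\cdot)$ means $(F(\cdot))^2$. "Immersion" is the term used for the discrete map $q:D\to\mathbb{R}^3$ obtained from $\nu$; no separate definition of discrete immersion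 is given.
   Formalization: The co-normal conditions are required for unit squares contained in D, and D is assumed to have no holes (every closed lattice walk in D contracts through unit squares in D); without this q need not exist, e.g. on {0,1,2}² minus (1,1). If every (u,v) in D has its square in D, this is automatic. *)

theory Defs
  imports "HOL-Analysis.Analysis"
begin

section \<open>Discrete derivatives\<close>

text \<open>
  Maps on a subset of the lattice are total functions on \<open>int \<times> int\<close> whose values outside
  that subset are irrelevant. Half-integer labels are rounded down: \<open>d1 f (u, v)\<close> is
  \<open>f\<^sub>1(u+1/2, v)\<close>, \<open>d2 f (u, v)\<close> is \<open>f\<^sub>2(u, v+1/2)\<close>, and \<open>d12 f (u, v)\<close> is
  \<open>f\<^sub>1\<^sub>2(u+1/2, v+1/2)\<close>. Hence \<open>d1 f (u-1, v)\<close> is \<open>f\<^sub>1(u-1/2, v)\<close>, and so on.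
\<close>

definition d1 :: "(int \<times> int \<Rightarrow> 'a::ab_group_add) \<Rightarrow> int \<times> int \<Rightarrow> 'a" where
  "d1 f = (\<lambda>(u, v). f (u + 1, v) - f (u, v))"

definition d2 :: "(int \<times> int \<Rightarrow> 'a::ab_group_add) \<Rightarrow> int \<times> int \<Rightarrow> 'a" where
  "d2 f = (\<lambda>(u, v). f (u, v + 1) - f (u, v))"

definition d11 :: "(int \<times> int \<Rightarrow> 'a::real_vector) \<Rightarrow> int \<times> int \<Rightarrow> 'a" where
  "d11 f = (\<lambda>(u, v). f (u + 1, v) - 2 *\<^sub>R f (u, v) + f (u - 1, v))"

definition d22 :: "(int \<times> int \<Rightarrow> 'a::real_vector) \<Rightarrow> int \<times> int \<Rightarrow> 'a" where
  "d22 f = (\<lambda>(u, v). f (u, v + 1) - 2 *\<^sub>R f (u, v) + f (u, v - 1))"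

definition d12 :: "(int \<times> int \<Rightarrow> 'a::ab_group_add) \<Rightarrow> int \<times> int \<Rightarrow> 'a" where
  "d12 f = (\<lambda>(u, v). f (u + 1, v + 1) + f (u, v) - f (u + 1, v) - f (u, v + 1))"

definition det3 :: "real^3 \<Rightarrow> real^3 \<Rightarrow> real^3 \<Rightarrow> real" where
  "det3 a b c = det (vector [a, b, c] :: real^3^3)"


section \<open>Discrete co-normal maps\<close>

definition unit_square :: "int \<times> int \<Rightarrow> (int \<times> int) set" where
  "unit_square = (\<lambda>(u, v). {(u, v), (u + 1, v), (u, v + 1), (u + 1, v + 1)})"

text \<open>\<open>conormal_F \<nu> (u, v)\<close> is \<open>F(u+1/2, v+1/2)\<close>.\<close>

definition conormal_F :: "(int \<times> int \<Rightarrow> real^3) \<Rightarrow> int \<times> int \<Rightarrow> real" where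
  "conormal_F \<nu> = (\<lambda>(u, v). \<nu> (u, v) \<bullet> cross3 (\<nu> (u, v + 1)) (\<nu> (u + 1, v)))"

definition discrete_conormal :: "(int \<times> int) set \<Rightarrow> (int \<times> int \<Rightarrow> real^3) \<Rightarrow> bool" where
  "discrete_conormal D \<nu> \<longleftrightarrow>
     (\<forall>u v. unit_square (u, v) \<subseteq> D \<longrightarrow> d12 \<nu> (u, v) = 0 \<and> conormal_F \<nu> (u, v) > 0)"


section \<open>Lattice domains without holes\<close>

definition lattice_adj :: "int \<times> int \<Rightarrow> int \<times> int \<Rightarrow> bool" where
  "lattice_adj p r \<longleftrightarrow> \<bar>fst p - fst r\<bar> + \<bar>snd p - snd r\<bar> = 1"

definition lattice_walk :: "(int \<times> int) set \<Rightarrow> (int \<times> int) list \<Rightarrow> bool" where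
  "lattice_walk D xs \<longleftrightarrow> xs \<noteq> [] \<and> set xs \<subseteq> D \<and> successively lattice_adj xs"

text \<open>
  A walk may be changed by deleting a step taken back and forth, or a tour around a unit square
  with all vertices in \<open>D\<close> (a closed walk with exactly four distinct vertices is such a tour,
  in either direction and from any corner).
\<close>

inductive elementary_move ::
  "(int \<times> int) set \<Rightarrow> (int \<times> int) list \<Rightarrow> (int \<times> int) list \<Rightarrow> bool" for D where
  spur: "{a, b} \<subseteq> D \<Longrightarrow> lattice_adj a b \<Longrightarrow>
    elementary_move D (xs @ [a, b, a] @ ys) (xs @ [a] @ ys)"
| square: "{a, b, c, d} \<subseteq> D \<Longrightarrow> successively lattice_adj [a, b, c, d, a] \<Longrightarrow> distinct [a, b, c, d] \<Longrightarrow>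
    elementary_move D (xs @ [a, b, c, d, a] @ ys) (xs @ [a] @ ys)"

definition walk_homotopic ::
  "(int \<times> int) set \<Rightarrow> (int \<times> int) list \<Rightarrow> (int \<times> int) list \<Rightarrow> bool" where
  "walk_homotopic D = equivclp (elementary_move D)"

text \<open>
  Every closed walk in \<open>D\<close> is contractible, that is, each component of the square complex
  spanned by \<open>D\<close> is simply connected. Connectedness of \<open>D\<close> is not required.
\<close>

definition lattice_simply_connected :: "(int \<times> int) set \<Rightarrow> bool" where
  "lattice_simply_connected D \<longleftrightarrow>
     (\<forall>xs. lattice_walk D xs \<and> hd xs = last xs \<longrightarrow> walk_homotopic D xs [hd xs])"


subsection \<open>Examples: rectangles, and domains closed under forward steps\<close>

lemma homotopic_refl [simp]: "walk_homotopic D xs xs"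
  by (simp add: walk_homotopic_def)

lemma homotopic_sym: "walk_homotopic D xs ys \<Longrightarrow> walk_homotopic D ys xs"
  by (simp add: walk_homotopic_def equivclp_sym)

lemma homotopic_trans [trans]:
  "walk_homotopic D xs ys \<Longrightarrow> walk_homotopic D ys zs \<Longrightarrow> walk_homotopic D xs zs"
  unfolding walk_homotopic_def by (rule equivclp_trans)

lemma homotopic_move: "elementary_move D xs ys \<Longrightarrow> walk_homotopic D xs ys"
  by (simp add: walk_homotopic_def r_into_equivclp)

lemma elementary_move_context:
  "elementary_move D xs ys \<Longrightarrow> elementary_move D (us @ xs @ vs) (us @ ys @ vs)"
proof (induction rule: elementary_move.induct)
  case (spur a b xs ys)
  then show ?case using elementary_move.spur[of a b D "us @ xs" "ys @ vs"] by simp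
next
  case (square a b c d xs ys)
  then show ?case using elementary_move.square[of a b c d D "us @ xs" "ys @ vs"] by simp
qed

lemma homotopic_context:
  "walk_homotopic D xs ys \<Longrightarrow> walk_homotopic D (us @ xs @ vs) (us @ ys @ vs)"
  unfolding walk_homotopic_def
proof (induction rule: equivclp_induct)
  case (step y z)
  then have "equivclp (elementary_move D) (us @ y @ vs) (us @ z @ vs)"
    by (metis elementary_move_context r_into_equivclp equivclp_sym)
  with step.IH show ?case by (rule equivclp_trans)
qed simp

lemma homotopic_Cons: "walk_homotopic D xs ys \<Longrightarrow> walk_homotopic D (a # xs) (a # ys)"
  using homotopic_context[of D xs ys "[a]" "[]"] by simp

lemma homotopic_mono:
  assumes "D \<subseteq> E" "walk_homotopic D xs ys"
  shows "walk_homotopic E xs ys"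
proof -
  have "elementary_move D \<le> elementary_move E"
  proof (intro le_funI le_boolI)
    fix xs ys assume "elementary_move D xs ys"
    then show "elementary_move E xs ys"
    proof cases
      case spur
      with assms(1) show ?thesis using elementary_move.spur[of _ _ E] by blast
    next
      case (square a b c d us vs)
      moreover have "{a, b, c, d} \<subseteq> E" using square assms(1) by blast
      ultimately show ?thesis using elementary_move.square[of a b c d E us vs] by blast
    qed
  qed
  then have "symclp (elementary_move D) \<le> symclp (elementary_move E)"
    by (auto simp: symclp_def le_fun_def)
  then show ?thesis using assms(2) rtranclp_mono
    unfolding walk_homotopic_def equivclp_def by blast
qed

lemma homotopic_rev:
  assumes "lattice_walk D xs"
  shows "walk_homotopic D (xs @ tl (rev xs)) [hd xs]"
  using assms
proof (induction xs rule: induct_list012)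
  case (3 a b xs)
  have D: "{a, b} \<subseteq> D" "lattice_adj a b" using 3 by (auto simp: lattice_walk_def)
  have walk: "lattice_walk D (b # xs)" using 3 by (auto simp: lattice_walk_def)
  have "rev (b # xs) \<noteq> []" by simp
  then have eq: "(a # b # xs) @ tl (rev (a # b # xs)) = [a] @ ((b # xs) @ tl (rev (b # xs))) @ [a]"
    by (simp add: tl_append split: list.split)
  have "walk_homotopic D ((b # xs) @ tl (rev (b # xs))) [b]" using 3(2)[OF walk] by simp
  then have "walk_homotopic D ((a # b # xs) @ tl (rev (a # b # xs))) [a, b, a]"
    unfolding eq using homotopic_context[of D _ "[b]" "[a]" "[a]"] by fastforce
  also have "walk_homotopic D [a, b, a] [a]"
    using homotopic_move[OF elementary_move.spur[OF D, of "[]" "[]"]] by simp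
  finally show ?case by simp
qed (auto simp: lattice_walk_def)

lemma lattice_simply_connected_box:
  fixes N M :: int
  assumes box: "\<And>u v. (u, v) \<in> D \<Longrightarrow> u \<le> N \<and> v \<le> M"
    and right: "\<And>u v. (u, v) \<in> D \<Longrightarrow> u < N \<Longrightarrow> (u + 1, v) \<in> D"
    and up: "\<And>u v. (u, v) \<in> D \<Longrightarrow> v < M \<Longrightarrow> (u, v + 1) \<in> D"
  shows "lattice_simply_connected D"
proof -
  define w where "w = (\<lambda>(u, v). map (\<lambda>i. (i, v)) [u..N] @ map (\<lambda>j. (N, j)) [v + 1..M])"
  have w_right: "w (u, v) = (u, v) # w (u + 1, v)" if "u < N" for u v
    using that by (simp add: w_def upto_rec1)
  have w_up: "w (N, v) = (N, v) # w (N, v + 1)" if "v < M" for v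
    using that by (simp add: w_def upto_rec1)
  have w_hd: "\<exists>t. w p = p # t" if "p \<in> D" for p
    using box that by (cases p) (auto simp: w_def upto_rec1)
  have w_top: "w (N, M) = [(N, M)]" by (simp add: w_def)
  have walk_Cons: "lattice_walk D (p # w r)"
    if "lattice_walk D (w r)" "p \<in> D" "r \<in> D" "lattice_adj p r" for p r
    using w_hd[OF that(3)] that by (auto simp: lattice_walk_def)
  have walk: "lattice_walk D (w (u, v))" if "(u, v) \<in> D" for u v
    using that
  proof (induction "nat (N - u) + nat (M - v)" arbitrary: u v rule: less_induct)
    case less
    consider "u < N" | "u = N" "v < M" | "u = N" "v = M"
      using box[OF less.prems] by linarith
    then show ?case
    proof cases
      case 1
      with less right[of u v] have "lattice_walk D (w (u + 1, v))" by simp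
      with 1 less right[of u v] show ?thesis
        by (simp add: w_right walk_Cons lattice_adj_def)
    next
      case 2
      with less up[of u v] have "lattice_walk D (w (u, v + 1))" by simp
      with 2 less up[of u v] show ?thesis
        by (simp add: w_up walk_Cons lattice_adj_def)
    next
      case 3
      with less show ?thesis by (simp add: w_top lattice_walk_def)
    qed
  qed
  have horiz: "walk_homotopic D ((u, v) # w (u, v + 1)) (w (u, v))" if "(u, v) \<in> D" "v < M" for u v
    using that
  proof (induction "nat (N - u)" arbitrary: u rule: less_induct)
    case less
    show ?case
    proof (cases "u < N")
      case False
      with box[OF less.prems(1)] have "u = N" by simp
      with less show ?thesis by (simp add: w_up)
    next
      case True
      define a b c d where abcd: "a = (u, v)" "b = (u + 1, v)" "c = (u + 1, v + 1)" "d = (u, v + 1)"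
      have inD: "a \<in> D" "b \<in> D" "c \<in> D" "d \<in> D"
        using less.prems True right up by (auto simp: abcd)
      have adj: "lattice_adj a b" "lattice_adj b c" "lattice_adj c d" "lattice_adj d a" "lattice_adj d c"
        by (auto simp: abcd lattice_adj_def)
      have dist: "distinct [a, b, c, d]" by (auto simp: abcd)
      obtain t where t: "w c = c # t" using w_hd inD by blast
      have "walk_homotopic D ([a, b, c, d, a] @ [d, c] @ t) ([a] @ [d, c] @ t)"
        using elementary_move.square[of a b c d D "[]" "[d, c] @ t"] inD adj dist
        by (intro homotopic_move) auto
      moreover have "walk_homotopic D ([a, b, c, d, a] @ [d, c] @ t) ([a, b, c, d, c] @ t)"
        using elementary_move.spur[of d a D "[a, b, c]" "[c] @ t"] inD adj
        by (intro homotopic_move) auto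
      moreover have "walk_homotopic D ([a, b, c, d, c] @ t) ([a, b, c] @ t)"
        using elementary_move.spur[of c d D "[a, b]" "t"] inD adj
        by (intro homotopic_move) auto
      ultimately have "walk_homotopic D ([a] @ [d, c] @ t) ([a, b, c] @ t)"
        by (meson homotopic_sym homotopic_trans)
      moreover have "walk_homotopic D (b # w c) (w b)"
        using less.hyps[of "u + 1"] less.prems True inD by (simp add: abcd)
      then have "walk_homotopic D (a # b # w c) (a # w b)" by (rule homotopic_Cons)
      ultimately have "walk_homotopic D (a # d # w c) (a # w b)"
        using t by (metis append_Cons append_Nil homotopic_trans)
      then show ?thesis using True by (simp add: abcd w_right)
    qed
  qed
  have spur_back: "walk_homotopic D (p # r # w p) (w p)" if "p \<in> D" "r \<in> D" "lattice_adj p r" for p r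
    using w_hd[OF that(1)] elementary_move.spur[of p r D "[]"] that by (auto intro!: homotopic_move)
  have edge: "walk_homotopic D (p # w r) (w p)"
    if pr: "p \<in> D" "r \<in> D" "lattice_adj p r" for p r
  proof -
    obtain u v u' v' where uv: "p = (u, v)" "r = (u', v')" by fastforce
    have "(u' = u + 1 \<and> v' = v) \<or> (u = u' + 1 \<and> v' = v) \<or> (u' = u \<and> v' = v + 1) \<or> (u' = u \<and> v = v' + 1)"
      using pr(3) by (auto simp: uv lattice_adj_def)
    then consider "u' = u + 1" "v' = v" | "u = u' + 1" "v' = v" | "u' = u" "v' = v + 1" | "u' = u" "v = v' + 1"
      by blast
    then show ?thesis
    proof cases
      case 1
      with box[of u' v'] pr show ?thesis by (simp add: uv w_right)
    next
      case 2
      then have "w r = r # w p" using box[of u v] pr by (simp add: uv w_right)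
      then show ?thesis using spur_back[OF pr] by simp
    next
      case 3
      with horiz[of u v] box[of u' v'] pr show ?thesis by (simp add: uv)
    next
      case 4
      then have "walk_homotopic D (r # w p) (w r)" using horiz[of u' v'] box[of u v] pr by (simp add: uv)
      then have "walk_homotopic D (p # w r) (p # r # w p)" by (rule homotopic_Cons[OF homotopic_sym])
      then show ?thesis using spur_back[OF pr] homotopic_trans by blast
    qed
  qed
  have main: "walk_homotopic D (butlast xs @ w (last xs)) (w (hd xs))" if "lattice_walk D xs" for xs
    using that
  proof (induction xs rule: induct_list012)
    case (3 a b xs)
    then have "lattice_walk D (b # xs)" by (auto simp: lattice_walk_def)
    from 3(2)[OF this] have "walk_homotopic D (butlast (b # xs) @ w (last (b # xs))) (w b)" by simp
    then have "walk_homotopic D (a # butlast (b # xs) @ w (last (b # xs))) (a # w b)"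
      by (rule homotopic_Cons)
    also have "walk_homotopic D (a # w b) (w a)"
      using 3(3) by (intro edge) (auto simp: lattice_walk_def)
    finally show ?case by simp
  qed (auto simp: lattice_walk_def)
  show ?thesis unfolding lattice_simply_connected_def
  proof (intro allI impI, elim conjE)
    fix xs assume xs: "lattice_walk D xs" "hd xs = last xs"
    define a where "a = hd xs"
    have a: "a \<in> D" "last xs = a" "xs = butlast xs @ [a]"
      using xs by (auto simp: a_def lattice_walk_def)
    have "lattice_walk D (w a)" using walk a(1) by (cases a) blast
    then have "walk_homotopic D (w a @ tl (rev (w a))) [hd (w a)]" by (rule homotopic_rev)
    then have loop: "walk_homotopic D (w a @ tl (rev (w a))) [a]" using w_hd[OF a(1)] by auto
    from homotopic_context[OF homotopic_sym[OF loop], of "butlast xs" "[]"]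
    have "walk_homotopic D xs (butlast xs @ w a @ tl (rev (w a)))"
      using a(3) by simp
    also have "walk_homotopic D \<dots> (w a @ tl (rev (w a)))"
      using homotopic_context[OF main[OF xs(1)], of "[]" "tl (rev (w a))"] a(2) a_def by simp
    also note loop
    finally show "walk_homotopic D xs [hd xs]" by (simp add: a_def)
  qed
qed

lemma lattice_simply_connected_rectangle: "lattice_simply_connected ({a..b} \<times> {c..d})"
  by (rule lattice_simply_connected_box[of _ b d]) auto

text \<open>
  If \<open>(u, v) \<in> D\<close> is always the lower-left vertex of a unit square in \<open>D\<close>, then the hypothesis on
  the shape of \<open>D\<close> is automatic.
\<close>

lemma lattice_simply_connected_forward_closed:
  assumes "\<And>u v. (u, v) \<in> D \<Longrightarrow> unit_square (u, v) \<subseteq> D"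
  shows "lattice_simply_connected D"
  unfolding lattice_simply_connected_def
proof (intro allI impI, elim conjE)
  fix xs assume xs: "lattice_walk D xs" "hd xs = last xs"
  define N M where "N = Max (fst ` set xs)" and "M = Max (snd ` set xs)"
  define E where "E = D \<inter> ({..N} \<times> {..M})"
  have "lattice_simply_connected E"
    by (rule lattice_simply_connected_box[of _ N M]) (use assms in \<open>auto simp: E_def unit_square_def\<close>)
  moreover have "fst p \<le> N \<and> snd p \<le> M" if "p \<in> set xs" for p
    using that by (auto simp: N_def M_def)
  then have "set xs \<subseteq> {..N} \<times> {..M}" by (auto simp: mem_Times_iff)
  then have "lattice_walk E xs" using xs by (auto simp: lattice_walk_def E_def)
  ultimately have "walk_homotopic E xs [hd xs]"
    using xs(2) by (simp add: lattice_simply_connected_def)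
  then show "walk_homotopic D xs [hd xs]" by (rule homotopic_mono[rotated]) (simp add: E_def)
qed

end

theory Submission
  imports Defs
begin

text \<open>
  The prescribed edge increments of \<open>q\<close> form a 1-form \<open>w\<close> on the lattice edges. The condition
  \<open>\<nu>\<^sub>1\<^sub>2 = 0\<close> says that opposite corners of a square have the same sum, which makes the sum of \<open>w\<close>
  around the square vanish; so summation of \<open>w\<close> along walks is invariant under homotopy, and \<open>w\<close>
  integrates to \<open>q\<close>. At each corner of a square, the cross product of the two increments is \<open>F \<nu>\<close>
  by the identity for \<open>(a \<times> b) \<times> (a \<times> c)\<close>. The increments at a point are orthogonal to \<open>\<nu>\<close> there,
  hence so are \<open>q\<^sub>1\<^sub>1\<close> and \<open>q\<^sub>2\<^sub>2\<close>, while \<open>\<nu> \<bullet> q\<^sub>1\<^sub>2 = F\<close> at every corner.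
\<close>

section \<open>Integration along lattice walks\<close>

fun walk_sum :: "('p \<Rightarrow> 'p \<Rightarrow> 'a::ab_group_add) \<Rightarrow> 'p list \<Rightarrow> 'a" where
  "walk_sum w (a # b # xs) = w a b + walk_sum w (b # xs)"
| "walk_sum w xs = 0"

text \<open>The cut vertex \<open>a\<close> is kept in both pieces: increments live on edges, so
  each edge is counted exactly once.\<close>

lemma walk_sum_append:
  "walk_sum w (xs @ a # ys) = walk_sum w (xs @ [a]) + walk_sum w (a # ys)"
  by (induction xs rule: induct_list012) (simp_all add: algebra_simps)

lemma lattice_adj_sym: "lattice_adj a b \<longleftrightarrow> lattice_adj b a"
  by (auto simp: lattice_adj_def)

lemma walk_sum_rev:
  assumes "lattice_walk D xs"
    and "\<And>a b. {a, b} \<subseteq> D \<Longrightarrow> lattice_adj a b \<Longrightarrow> w a b + w b a = 0"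
  shows "walk_sum w (rev xs) = - walk_sum w xs"
  using assms(1)
proof (induction xs rule: induct_list012)
  case (3 a b xs)
  then have "walk_sum w (rev (b # xs)) = - walk_sum w (b # xs)"
    by (simp add: lattice_walk_def)
  moreover have "w b a = - w a b"
    using 3(3) assms(2)[of a b] by (simp add: lattice_walk_def eq_neg_iff_add_eq_0 add.commute)
  ultimately show ?case
    using walk_sum_append[of w "rev xs" b "[a]"] by simp
qed auto

text \<open>A move removes a closed detour based at \<open>a\<close>. Cutting at \<open>a\<close>
  isolates its contribution, which is zero by \<open>spur\<close> or \<open>square\<close>; the
  equivalence closure then only chains such equalities in either direction.\<close>

lemma walk_sum_homotopic:
  fixes w :: "int \<times> int \<Rightarrow> int \<times> int \<Rightarrow> 'a::ab_group_add"
  assumes spur: "\<And>a b. {a, b} \<subseteq> D \<Longrightarrow> lattice_adj a b \<Longrightarrow> w a b + w b a = 0"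
    and square: "\<And>a b c d. {a, b, c, d} \<subseteq> D \<Longrightarrow> successively lattice_adj [a, b, c, d, a] \<Longrightarrow>
      distinct [a, b, c, d] \<Longrightarrow> w a b + w b c + w c d + w d a = 0"
    and "walk_homotopic D xs ys"
  shows "walk_sum w xs = walk_sum w ys"
proof -
  have move: "walk_sum w xs = walk_sum w ys" if "elementary_move D xs ys" for xs ys
    using that
  proof cases
    case (spur a b us vs)
    then show ?thesis
      using assms(1)[of a b] walk_sum_append[of w us a "b # a # vs"] walk_sum_append[of w us a vs]
      by (simp add: add.assoc[symmetric])
  next
    case (square a b c d us vs)
    then show ?thesis
      using assms(2)[of a b c d] walk_sum_append[of w us a "b # c # d # a # vs"]
        walk_sum_append[of w us a vs]
      by (simp add: add.assoc[symmetric])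
  qed
  show ?thesis
    using assms(3) unfolding walk_homotopic_def
    by (induction rule: equivclp_induct) (use move in metis)+
qed

lemma lattice_walk_rev: "lattice_walk D (rev xs) \<longleftrightarrow> lattice_walk D xs"
proof -
  have "(\<lambda>x y. lattice_adj y x) = lattice_adj"
    by (intro ext) (rule lattice_adj_sym)
  then have "successively (\<lambda>x y. lattice_adj y x) xs = successively lattice_adj xs"
    by (rule arg_cong)
  then show ?thesis
    by (simp add: lattice_walk_def)
qed

lemma lattice_walk_join:
  assumes "lattice_walk D xs" "lattice_walk D ys" "lattice_adj (last xs) (hd ys)"
  shows "lattice_walk D (xs @ ys)"
  using assms by (auto simp: lattice_walk_def successively_append_iff)

text \<open>
  As \<open>D\<close> need not be connected, each point is integrated from a base point of its own component;
  \<open>base\<close> depends only on the component because the choice predicates of adjacent points coincide.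
\<close>

lemma lattice_potential:
  fixes w :: "int \<times> int \<Rightarrow> int \<times> int \<Rightarrow> 'a::ab_group_add"
  assumes sc: "lattice_simply_connected D"
    and spur: "\<And>a b. {a, b} \<subseteq> D \<Longrightarrow> lattice_adj a b \<Longrightarrow> w a b + w b a = 0"
    and square: "\<And>a b c d. {a, b, c, d} \<subseteq> D \<Longrightarrow> successively lattice_adj [a, b, c, d, a] \<Longrightarrow>
      distinct [a, b, c, d] \<Longrightarrow> w a b + w b c + w c d + w d a = 0"
  obtains q where "\<And>a b. {a, b} \<subseteq> D \<Longrightarrow> lattice_adj a b \<Longrightarrow> q b - q a = w a b"
proof -
  define joins where "joins r p xs \<longleftrightarrow> lattice_walk D xs \<and> hd xs = r \<and> last xs = p" for r p xs
  define base where "base p = (SOME r. \<exists>xs. joins r p xs)" for p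
  define path where "path p = (SOME xs. joins (base p) p xs)" for p
  have path: "joins (base p) p (path p)" if "p \<in> D" for p
  proof -
    have "joins p p [p]"
      using that by (simp add: joins_def lattice_walk_def)
    then have "\<exists>r xs. joins r p xs" by blast
    then have "\<exists>xs. joins (base p) p xs"
      unfolding base_def by (rule someI_ex)
    then show ?thesis
      unfolding path_def by (rule someI_ex)
  qed
  have joins_step: "joins r b (xs @ [b])" if "joins r a xs" "b \<in> D" "lattice_adj a b" for r a b xs
    using that lattice_walk_join[of D xs "[b]"] by (auto simp: joins_def lattice_walk_def)
  have base: "base a = base b" if "{a, b} \<subseteq> D" "lattice_adj a b" for a b
  proof -
    have "(\<lambda>r. \<exists>xs. joins r a xs) = (\<lambda>r. \<exists>xs. joins r b xs)"
      using that joins_step lattice_adj_sym by (intro ext iffI) (meson insert_subset)+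
    then show ?thesis
      unfolding base_def by simp
  qed
  \<comment> \<open>The potential is \<open>walk_sum w (path p)\<close> as a function of
    \<open>p\<close>; it is fixed by unification with the last \<open>show\<close> of this
    block.\<close>
  show thesis
  proof
    fix a b assume ab: "{a, b} \<subseteq> D" "lattice_adj a b"
    from path[of a] path[of b] ab obtain xs ys
      where xs: "path a = xs @ [a]" and ys: "path b = ys @ [b]"
      by (metis append_butlast_last_id insert_subset joins_def lattice_walk_def)
    \<comment> \<open>\<open>l\<close> runs from the base point to \<open>a\<close>, crosses the
      edge to \<open>b\<close> and returns along the reversed path of \<open>b\<close>. It is closed
      because adjacent points share their base, so its sum vanishes, which isolates
      \<open>w a b\<close>.\<close>
    define l where "l = path a @ rev (path b)"
    have walks: "lattice_walk D (path a)" "lattice_walk D (path b)"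
      using path ab by (auto simp: joins_def)
    then have l: "lattice_walk D l"
      unfolding l_def by (intro lattice_walk_join) (use ab xs ys lattice_walk_rev[of D "path b"] in auto)
    have "hd l = base a" "last l = base b"
      using path[of a] path[of b] ab by (auto simp: l_def joins_def lattice_walk_def last_rev)
    with base[OF ab] l sc have "walk_homotopic D l [hd l]"
      unfolding lattice_simply_connected_def by metis
    from walk_sum_homotopic[OF spur square this] have "walk_sum w l = 0"
      by simp
    moreover have "walk_sum w l = walk_sum w (path a) + w a b + walk_sum w (rev (path b))"
      using walk_sum_append[of w xs a "rev (path b)"] by (simp add: l_def xs ys add.assoc)
    ultimately show "walk_sum w (path b) - walk_sum w (path a) = w a b"
      using walk_sum_rev[OF walks(2) spur] by (simp add: algebra_simps)
  qed
qed

text \<open>Two consecutive steps along the same axis would force \<open>a = c\<close> or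
  \<open>b = d\<close>, so horizontal and vertical steps alternate. The cases differ in the axis of
  the first step; the absolute values cover all starting corners and orientations.\<close>

lemma square_tour_cases:
  assumes "successively lattice_adj [a, b, c, d, a]" "distinct [a, b, c, d]"
  obtains x x' y y' where "\<bar>x - x'\<bar> = 1" "\<bar>y - y'\<bar> = 1"
      "a = (x, y)" "b = (x', y)" "c = (x', y')" "d = (x, y')"
    | x x' y y' where "\<bar>x - x'\<bar> = 1" "\<bar>y - y'\<bar> = 1"
      "a = (x, y)" "b = (x, y')" "c = (x', y')" "d = (x', y)"
proof -
  obtain a1 a2 b1 b2 c1 c2 d1 d2 where p:
    "a = (a1, a2)" "b = (b1, b2)" "c = (c1, c2)" "d = (d1, d2)"
    by (metis surj_pair)
  have adj: "\<bar>a1 - b1\<bar> + \<bar>a2 - b2\<bar> = 1" "\<bar>b1 - c1\<bar> + \<bar>b2 - c2\<bar> = 1"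
    "\<bar>c1 - d1\<bar> + \<bar>c2 - d2\<bar> = 1" "\<bar>d1 - a1\<bar> + \<bar>d2 - a2\<bar> = 1"
    using assms(1) by (simp_all add: p lattice_adj_def)
  have "a1 \<noteq> c1 \<or> a2 \<noteq> c2" "b1 \<noteq> d1 \<or> b2 \<noteq> d2"
    using assms(2) by (auto simp: p)
  with adj have "b2 = a2 \<and> c1 = b1 \<and> d1 = a1 \<and> d2 = c2 \<or> b1 = a1 \<and> c2 = b2 \<and> d2 = a2 \<and> d1 = c1"
    by smt
  then show thesis
    using that adj unfolding p by auto
qed

section \<open>Discrete asymptotic nets\<close>

lemma det3_eq_inner: "det3 a b c = cross3 a b \<bullet> c"
  by (simp only: det3_def dot_cross_det[symmetric] inner_commute[of a] cross_triple[of a b c])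

lemma cross_cross_common: "cross3 (cross3 n s) (cross3 n t) = (n \<bullet> cross3 s t) *\<^sub>R n"
  by (simp add: vec_eq_iff forall_3 cross3_def inner_vec_def sum_3; algebra)

text \<open>One formula serves both directions of travel: \<open>cross3\<close> is skew, so the sign
  needs to depend only on whether the edge is horizontal.\<close>

definition conormal_form :: "(int \<times> int \<Rightarrow> real^3) \<Rightarrow> int \<times> int \<Rightarrow> int \<times> int \<Rightarrow> real^3" where
  "conormal_form \<nu> a b = (if snd a = snd b then cross3 (\<nu> a) (\<nu> b) else - cross3 (\<nu> a) (\<nu> b))"

text \<open>Each of the four sign choices describes some unit square seen from another corner. The
  relation between its diagonals is symmetric, so it reduces to \<nu>12 = 0 at the lower-left
  vertex.\<close>

lemma discrete_conormal_diagonals: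
  assumes con: "discrete_conormal D \<nu>"
    and D: "{(x, y), (x', y), (x', y'), (x, y')} \<subseteq> D"
    and "\<bar>x - x'\<bar> = 1" "\<bar>y - y'\<bar> = 1"
  shows "\<nu> (x, y) + \<nu> (x', y') = \<nu> (x', y) + \<nu> (x, y')"
proof -
  have diag: "\<nu> (u, v) + \<nu> (u + 1, v + 1) = \<nu> (u + 1, v) + \<nu> (u, v + 1)"
    if "unit_square (u, v) \<subseteq> D" for u v
    using con that unfolding discrete_conormal_def d12_def
    by (subst add.commute[of "\<nu> (u, v)"]) (simp add: diff_diff_eq)
  have "x' = x + 1 \<or> x = x' + 1" "y' = y + 1 \<or> y = y' + 1"
    using assms(3,4) by linarith+
  then show ?thesis
    using diag[of x y] diag[of x' y] diag[of x y'] diag[of x' y'] D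
    by (elim disjE) (simp_all add: unit_square_def add.commute)
qed

text \<open>Eliminating the corner opposite \<open>a\<close> by the diagonal relation leaves only
  cross products among \<open>a\<close>, \<open>b\<close>, \<open>d\<close> (their \<nu>-values),
  which cancel by bilinearity and skewness.\<close>

lemma conormal_form_square:
  assumes con: "discrete_conormal D \<nu>" and D: "{a, b, c, d} \<subseteq> D"
    and tour: "successively lattice_adj [a, b, c, d, a]" "distinct [a, b, c, d]"
  shows "conormal_form \<nu> a b + conormal_form \<nu> b c + conormal_form \<nu> c d + conormal_form \<nu> d a = 0"
  using tour
proof (cases rule: square_tour_cases)
  case (1 x x' y y')
  have "\<nu> a + \<nu> c = \<nu> b + \<nu> d"
    using discrete_conormal_diagonals[OF con _ 1(1,2)] D 1 by simp
  then have c: "\<nu> c = \<nu> b + \<nu> d - \<nu> a"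
    by (simp add: eq_diff_eq add.commute)
  \<comment> \<open>This decides the test \<open>snd a = snd b\<close> on the vertical edges, so the
    signs alternate around the tour.\<close>
  have "y \<noteq> y'" using 1(2) by auto
  then have "conormal_form \<nu> a b + conormal_form \<nu> b c + conormal_form \<nu> c d + conormal_form \<nu> d a
    = cross3 (\<nu> a) (\<nu> b) - cross3 (\<nu> b) (\<nu> c) + cross3 (\<nu> c) (\<nu> d) - cross3 (\<nu> d) (\<nu> a)"
    unfolding conormal_form_def using 1 by simp
  also have "\<dots> = 0"
    unfolding c by (simp add: vec_eq_iff forall_3 cross3_def algebra_simps)
  finally show ?thesis .
next
  case (2 x x' y y')
  have "\<nu> a + \<nu> c = \<nu> b + \<nu> d"
    using discrete_conormal_diagonals[OF con _ 2(1,2)] D 2 by (simp add: insert_commute add.commute)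
  then have c: "\<nu> c = \<nu> b + \<nu> d - \<nu> a"
    by (simp add: eq_diff_eq add.commute)
  have "y \<noteq> y'" using 2(2) by auto
  then have "conormal_form \<nu> a b + conormal_form \<nu> b c + conormal_form \<nu> c d + conormal_form \<nu> d a
    = - cross3 (\<nu> a) (\<nu> b) + cross3 (\<nu> b) (\<nu> c) - cross3 (\<nu> c) (\<nu> d) + cross3 (\<nu> d) (\<nu> a)"
    unfolding conormal_form_def using 2 by simp
  also have "\<dots> = 0"
    unfolding c by (simp add: vec_eq_iff forall_3 cross3_def algebra_simps)
  finally show ?thesis .
qed

section \<open>Existence of the net and its asymptotic properties\<close>

theorem theorem1:
  fixes D :: "(int \<times> int) set" and \<nu> :: "int \<times> int \<Rightarrow> real^3"
  assumes "lattice_simply_connected D"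
    and "discrete_conormal D \<nu>"
  shows "\<exists>q :: int \<times> int \<Rightarrow> real^3.
    (\<forall>u v. {(u, v), (u + 1, v)} \<subseteq> D \<longrightarrow>
       d1 q (u, v) = cross3 (\<nu> (u, v)) (\<nu> (u + 1, v))) \<and>
    (\<forall>u v. {(u, v), (u, v + 1)} \<subseteq> D \<longrightarrow>
       d2 q (u, v) = - cross3 (\<nu> (u, v)) (\<nu> (u, v + 1))) \<and>
    (\<forall>u v. unit_square (u, v) \<subseteq> D \<longrightarrow>
       \<nu> (u, v) = (1 / conormal_F \<nu> (u, v)) *\<^sub>R cross3 (d1 q (u, v)) (d2 q (u, v))) \<and>
    (\<forall>u v. unit_square (u - 1, v) \<subseteq> D \<longrightarrow>
       \<nu> (u, v) = (1 / conormal_F \<nu> (u - 1, v)) *\<^sub>R cross3 (d1 q (u - 1, v)) (d2 q (u, v))) \<and>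
    (\<forall>u v. unit_square (u - 1, v - 1) \<subseteq> D \<longrightarrow>
       \<nu> (u, v) = (1 / conormal_F \<nu> (u - 1, v - 1)) *\<^sub>R cross3 (d1 q (u - 1, v)) (d2 q (u, v - 1))) \<and>
    (\<forall>u v. unit_square (u, v - 1) \<subseteq> D \<longrightarrow>
       \<nu> (u, v) = (1 / conormal_F \<nu> (u, v - 1)) *\<^sub>R cross3 (d1 q (u, v)) (d2 q (u, v - 1))) \<and>
    (\<forall>u v. \<forall>i\<in>{u, u - 1}. \<forall>j\<in>{v, v - 1}.
       {(u - 1, v), (u, v), (u + 1, v), (u, j), (u, j + 1)} \<subseteq> D \<longrightarrow>
       det3 (d1 q (i, v)) (d2 q (u, j)) (d11 q (u, v)) = 0) \<and>
    (\<forall>u v. \<forall>i\<in>{u, u - 1}. \<forall>j\<in>{v, v - 1}.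
       {(u, v - 1), (u, v), (u, v + 1), (i, v), (i + 1, v)} \<subseteq> D \<longrightarrow>
       det3 (d1 q (i, v)) (d2 q (u, j)) (d22 q (u, v)) = 0) \<and>
    (\<forall>u v. unit_square (u, v) \<subseteq> D \<longrightarrow>
       det3 (d1 q (u, v)) (d2 q (u, v)) (d12 q (u, v)) = (conormal_F \<nu> (u, v))\<^sup>2 \<and>
       det3 (d1 q (u, v)) (d2 q (u + 1, v)) (d12 q (u, v)) = (conormal_F \<nu> (u, v))\<^sup>2 \<and>
       det3 (d1 q (u, v + 1)) (d2 q (u, v)) (d12 q (u, v)) = (conormal_F \<nu> (u, v))\<^sup>2 \<and>
       det3 (d1 q (u, v + 1)) (d2 q (u + 1, v)) (d12 q (u, v)) = (conormal_F \<nu> (u, v))\<^sup>2)"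
proof -
  have anti: "conormal_form \<nu> a b + conormal_form \<nu> b a = 0" for a b
    using cross_skew[of "\<nu> a" "\<nu> b"] by (simp add: conormal_form_def)
  obtain q where q: "\<And>a b. {a, b} \<subseteq> D \<Longrightarrow> lattice_adj a b \<Longrightarrow> q b - q a = conormal_form \<nu> a b"
    using lattice_potential[OF assms(1), of "conormal_form \<nu>"]
      conormal_form_square[OF assms(2)] anti by metis
  have q1: "d1 q (u, v) = cross3 (\<nu> (u, v)) (\<nu> (u + 1, v))" if "{(u, v), (u + 1, v)} \<subseteq> D" for u v
    using q[OF that] by (simp add: d1_def conormal_form_def lattice_adj_def)
  have q2: "d2 q (u, v) = - cross3 (\<nu> (u, v)) (\<nu> (u, v + 1))" if "{(u, v), (u, v + 1)} \<subseteq> D" for u v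
    using q[OF that] by (simp add: d2_def conormal_form_def lattice_adj_def)

  \<comment> \<open>All identities over one square are collected by corner. Substituting
    \<open>c = b + d - a\<close> changes the triple product at another corner only by terms with a
    repeated factor, so the same F, with the same sign, appears at all four corners.\<close>
  have sq: "cross3 (d1 q (u, v)) (d2 q (u, v)) = conormal_F \<nu> (u, v) *\<^sub>R \<nu> (u, v)"
    "cross3 (d1 q (u, v)) (d2 q (u + 1, v)) = conormal_F \<nu> (u, v) *\<^sub>R \<nu> (u + 1, v)"
    "cross3 (d1 q (u, v + 1)) (d2 q (u, v)) = conormal_F \<nu> (u, v) *\<^sub>R \<nu> (u, v + 1)"
    "cross3 (d1 q (u, v + 1)) (d2 q (u + 1, v)) = conormal_F \<nu> (u, v) *\<^sub>R \<nu> (u + 1, v + 1)"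
    "\<forall>x \<in> unit_square (u, v). \<nu> x \<bullet> d12 q (u, v) = conormal_F \<nu> (u, v)"
    "conormal_F \<nu> (u, v) > 0"
    if s: "unit_square (u, v) \<subseteq> D" for u v
  proof -
    define a b d where abcd: "a = \<nu> (u, v)" "b = \<nu> (u + 1, v)" "d = \<nu> (u, v + 1)"
    define c where c: "c = \<nu> (u + 1, v + 1)"
    have con: "d12 \<nu> (u, v) = 0" "conormal_F \<nu> (u, v) > 0"
      using s assms(2) by (auto simp: discrete_conormal_def)
    then have c': "c = b + d - a"
      by (simp add: d12_def abcd c algebra_simps)
    have F: "conormal_F \<nu> (u, v) = a \<bullet> cross3 d b"
      by (simp add: conormal_F_def abcd)
    have e: "d1 q (u, v) = cross3 a b" "d2 q (u, v) = - cross3 a d"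
        "d1 q (u, v + 1) = cross3 d c" "d2 q (u + 1, v) = - cross3 b c"
      using s by (simp_all add: q1 q2 unit_square_def abcd c)
    \<comment> \<open>The mixed difference is the difference of the two vertical increments, both
      already known as cross products.\<close>
    have "d12 q (u, v) = d2 q (u + 1, v) - d2 q (u, v)"
      by (simp add: d12_def d2_def)
    then have q12: "d12 q (u, v) = cross3 a d - cross3 b c"
      by (simp add: e)
    note coords = cross3_def vec_eq_iff forall_3 inner_vec_def sum_3
    show "cross3 (d1 q (u, v)) (d2 q (u, v)) = conormal_F \<nu> (u, v) *\<^sub>R \<nu> (u, v)"
      unfolding e F abcd(1)[symmetric] by (simp add: coords; algebra)
    show "cross3 (d1 q (u, v)) (d2 q (u + 1, v)) = conormal_F \<nu> (u, v) *\<^sub>R \<nu> (u + 1, v)"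
      unfolding e F abcd(2)[symmetric] c' by (simp add: coords; algebra)
    show "cross3 (d1 q (u, v + 1)) (d2 q (u, v)) = conormal_F \<nu> (u, v) *\<^sub>R \<nu> (u, v + 1)"
      unfolding e F abcd(3)[symmetric] c' by (simp add: coords; algebra)
    show "cross3 (d1 q (u, v + 1)) (d2 q (u + 1, v)) = conormal_F \<nu> (u, v) *\<^sub>R \<nu> (u + 1, v + 1)"
      unfolding e F c[symmetric] c' by (simp add: coords; algebra)
    show "\<forall>x \<in> unit_square (u, v). \<nu> x \<bullet> d12 q (u, v) = conormal_F \<nu> (u, v)"
      unfolding q12 F
      by (simp add: unit_square_def abcd[symmetric] c[symmetric]; simp add: c' coords; algebra)
    show "conormal_F \<nu> (u, v) > 0" by (rule con(2))
  qed

  \<comment> \<open>Both horizontal increments at \<open>(u, v)\<close> get \<nu>(u, v) as left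
    factor; for the edge arriving from the left, skewness moves it there. \<open>q2'\<close> does
    the same vertically, so \<open>cross_cross_common\<close> applies to every choice of
    signs.\<close>
  have q1': "\<exists>s. d1 q (i, v) = cross3 (\<nu> (u, v)) s"
    if i: "i \<in> {u, u - 1}" and D: "{(i, v), (i + 1, v)} \<subseteq> D" for i u v
  proof (cases "i = u")
    case False
    with i q1[OF D] have "d1 q (i, v) = cross3 (\<nu> (u, v)) (- \<nu> (i, v))"
      by (metis add_diff_cancel_right' cross_minus_right cross_skew diff_add_cancel insertE singletonD)
    then show ?thesis ..
  qed (use q1[OF D] in blast)
  have q2': "\<exists>t. d2 q (u, j) = cross3 (\<nu> (u, v)) t"
    if j: "j \<in> {v, v - 1}" and D: "{(u, j), (u, j + 1)} \<subseteq> D" for j u v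
  proof (cases "j = v")
    case True
    with q2[OF D] have "d2 q (u, j) = cross3 (\<nu> (u, v)) (- \<nu> (u, v + 1))"
      by (simp add: cross_minus_right)
    then show ?thesis ..
  next
    case False
    with j q2[OF D] have "d2 q (u, j) = cross3 (\<nu> (u, v)) (\<nu> (u, j))"
      by (metis cross_skew diff_add_cancel insertE singletonD)
    then show ?thesis ..
  qed
  have d11: "d11 q (u, v) = d1 q (u, v) - d1 q (u - 1, v)" for u v
    by (simp add: d11_def d1_def scaleR_2)
  have d22: "d22 q (u, v) = d2 q (u, v) - d2 q (u, v - 1)" for u v
    by (simp add: d22_def d2_def scaleR_2)
  have asym1: "det3 (d1 q (i, v)) (d2 q (u, j)) (d11 q (u, v)) = 0"
    if i: "i \<in> {u, u - 1}" and j: "j \<in> {v, v - 1}"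
      and D: "{(u - 1, v), (u, v), (u + 1, v), (u, j), (u, j + 1)} \<subseteq> D" for u v i j
  proof -
    have "{(i, v), (i + 1, v)} \<subseteq> D" using i D by auto
    with q1' i obtain s where "d1 q (i, v) = cross3 (\<nu> (u, v)) s" by blast
    moreover obtain t where "d2 q (u, j) = cross3 (\<nu> (u, v)) t" using q2'[OF j] D by auto
    moreover obtain r r' where "d1 q (u, v) = cross3 (\<nu> (u, v)) r" "d1 q (u - 1, v) = cross3 (\<nu> (u, v)) r'"
      using q1'[of u u v] q1'[of "u - 1" u v] D by auto
    \<comment> \<open>The cross product of the two increments is a multiple of \<nu>(u, v), while
      \<open>d11\<close> is a difference of vectors orthogonal to \<nu>(u, v).\<close>
    ultimately show ?thesis
      by (simp add: d11 det3_eq_inner cross_cross_common inner_diff_right dot_cross_self)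
  qed
  have asym2: "det3 (d1 q (i, v)) (d2 q (u, j)) (d22 q (u, v)) = 0"
    if i: "i \<in> {u, u - 1}" and j: "j \<in> {v, v - 1}"
      and D: "{(u, v - 1), (u, v), (u, v + 1), (i, v), (i + 1, v)} \<subseteq> D" for u v i j
  proof -
    have "{(u, j), (u, j + 1)} \<subseteq> D" using j D by auto
    with q2' j obtain t where "d2 q (u, j) = cross3 (\<nu> (u, v)) t" by blast
    moreover obtain s where "d1 q (i, v) = cross3 (\<nu> (u, v)) s" using q1'[OF i] D by auto
    moreover obtain r r' where "d2 q (u, v) = cross3 (\<nu> (u, v)) r" "d2 q (u, v - 1) = cross3 (\<nu> (u, v)) r'"
      using q2'[of v v u] q2'[of "v - 1" v u] D by auto
    ultimately show ?thesis
      by (simp add: d22 det3_eq_inner cross_cross_common inner_diff_right dot_cross_self)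
  qed
  show ?thesis
  proof (rule exI[of _ q], intro conjI allI ballI impI)
    fix u v
    show "\<nu> (u, v) = (1 / conormal_F \<nu> (u, v)) *\<^sub>R cross3 (d1 q (u, v)) (d2 q (u, v))"
      if "unit_square (u, v) \<subseteq> D"
      using sq(1,6)[OF that] by simp
    \<comment> \<open>Here \<open>(u, v)\<close> is the lower-right corner of the shifted square,
      hence \<open>sq(2)\<close>; the next two formulas see it as the upper-right and the upper-left
      corner.\<close>
    show "\<nu> (u, v) = (1 / conormal_F \<nu> (u - 1, v)) *\<^sub>R cross3 (d1 q (u - 1, v)) (d2 q (u, v))"
      if "unit_square (u - 1, v) \<subseteq> D"
      using sq(2,6)[OF that] by simp
    show "\<nu> (u, v) = (1 / conormal_F \<nu> (u - 1, v - 1)) *\<^sub>R cross3 (d1 q (u - 1, v)) (d2 q (u, v - 1))"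
      if "unit_square (u - 1, v - 1) \<subseteq> D"
      using sq(4,6)[OF that] by simp
    show "\<nu> (u, v) = (1 / conormal_F \<nu> (u, v - 1)) *\<^sub>R cross3 (d1 q (u, v)) (d2 q (u, v - 1))"
      if "unit_square (u, v - 1) \<subseteq> D"
      using sq(3,6)[OF that] by simp
  next
    fix u v assume "unit_square (u, v) \<subseteq> D"
    note s = sq[OF this]
    \<comment> \<open>Each pair of edges meets in one corner of the square. One factor F comes from
      its cross product F \<nu>, the other from the inner product of that \<nu> with
      \<open>d12 q\<close>.\<close>
    show "det3 (d1 q (u, v)) (d2 q (u, v)) (d12 q (u, v)) = (conormal_F \<nu> (u, v))\<^sup>2"
      "det3 (d1 q (u, v)) (d2 q (u + 1, v)) (d12 q (u, v)) = (conormal_F \<nu> (u, v))\<^sup>2"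
      "det3 (d1 q (u, v + 1)) (d2 q (u, v)) (d12 q (u, v)) = (conormal_F \<nu> (u, v))\<^sup>2"
      "det3 (d1 q (u, v + 1)) (d2 q (u + 1, v)) (d12 q (u, v)) = (conormal_F \<nu> (u, v))\<^sup>2"
      using s(5) by (simp_all add: det3_eq_inner s(1-4) unit_square_def power2_eq_square)
  qed (fact q1 q2 asym1 asym2)+
qed

end
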